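(* Assume that $\mathfrak d$ is regular. Then for each nonmeager filter $\mathcal F$ with $\mathfrak b(\mathcal F)=\mathfrak d$, there is a cofinal $\mathfrak b(\mathcal F)$-scale $S=\{a_\alpha:\alpha<\mathfrak d\}\subseteq[\mathbb N]^{(\aleph_0,\aleph_0)}$ such that: (1) all finite powers of the set $X=S\cup Q$ satisfy $\mathbf B(\mathcal F)$, but (2) the homeomorphic copy $\tilde X=\{\mathbb N\setminus x:x\in X\}$ of $X$ is a splitting and unbounded (with respect to $\le^*$) subset of $[\mathbb N]^{\aleph_0}$.
   Context: $\mathbb N=\{0,1,2,\dots\}$, discrete; $\mathbb N^{\mathbb N}$ has the product topology. $P(\mathbb N)$ carries the topology of $\{0,1\}^{\mathbb N}$ via characteristic functions. $[\mathbb N]^{\aleph_0}$ is the family of infinite subsets of $\mathbb N$ and $[\mathbb N]^{(\aleph_0,\aleph_0)}$ the family of infinite coinfinite subsets; $A\subseteq^*B$ means $A\setminus B$ is finite. A semifilter is a nonempty $\mathcal F\subseteq[\mathbb N]^{\aleph_0}$ such that $A\in\mathcal F$, $B\subseteq\mathbb N$ and $A\subseteq^*B$ imply $B\in\mathcal F$. A filter is a semifilter closed under finite intersections; nonmeager means nonmeager as a subset of $P(\mathbb N)$ (equivalently, of $[\mathbb N]^{\aleph_0}$). For $f,g\in\mathbb N^{\mathbb N}$, $f\le_{\mathcal F}g$ means $\{n:f(n)\le g(n)\}\in\mathcal F$, and $f\le^*g$ means $f(n)\le g(n)$ for all but finitely many $n$. A set $Y\subseteq\mathbb N^{\mathbb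 N}$ is bounded with respect to such a relation $R$ if there is $g\in\mathbb N^{\mathbb N}$ with $f\,R\,g$ for all $f\in Y$; otherwise it is unbounded. $\mathfrak b(\mathcal F)$ is the minimal cardinality of a subset of $\mathbb N^{\mathbb N}$ unbounded with respect to $\le_{\mathcal F}$; $\mathfrak d$ is the minimal cardinality of a dominating family, i.e. of a $D\subseteq\mathbb N^{\mathbb N}$ such that each $g\in\mathbb N^{\mathbb N}$ satisfies $g\le^*f$ for some $f\in D$. A space satisfies $\mathbf B(\mathcal F)$ if each of its continuous images in $\mathbb N^{\mathbb N}$ is bounded with respect to $\le_{\mathcal F}$. Identifications: $\mathbb N^{\uparrow\mathbb N}$ is the set of (strictly) increasing elements of $\mathbb N^{\mathbb N}$. $\overline{\mathbb N}=\mathbb N\cup\{\infty\}$ is the one-point compactification of $\mathbb N$, and $\overline{\mathbb N}^{\uparrow\mathbb N}$ is the subspace of $\overline{\mathbb N}^{\mathbb N}$ consisting of the nondecreasing $f$ such that $f(n)<f(n+1)$ whenever $f(n)<\infty$. The map $f\mapsto\operatorname{im}(f)\setminus\{\infty\}$ is a homeomorphism of $\overline{\mathbb N}^{\uparrow\mathbb N}$ onto $P(\mathbb N)$, carrying $\mathbb N^{\uparrow\mathbb N}$ onto $[\mathbb N]^{\aleph_0}$ and $Q$, the set of those $f\in\overline{\mathbb N}^{\uparrow\mathbb N}$ taking the value $\infty$, onto the family of finite subsets of $\mathbb N$. Using it, $\overline{\mathbb N}^{\uparrow\mathbb N}$ is identified with $P(\mathbb N)$: each infinite $a\subseteq\mathbb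 N$ is identified with its increasing enumeration (this is how $\le_{\mathcal F}$, $\le^*$ and (un)boundedness are applied to infinite sets), and $Q$ is identified with the family of finite subsets of $\mathbb N$. A cofinal $\mathfrak b(\mathcal F)$-scale is a family $\{f_\alpha:\alpha<\mathfrak b(\mathcal F)\}\subseteq\mathbb N^{\uparrow\mathbb N}$ such that $f_\alpha\le_{\mathcal F}f_\beta$ for all $\alpha<\beta<\mathfrak b(\mathcal F)$, and for each $g\in\mathbb N^{\mathbb N}$ there is $\alpha<\mathfrak b(\mathcal F)$ such that $g\le_{\mathcal F}f_\beta$ for each $\beta\ge\alpha$. A family $Y\subseteq P(\mathbb N)$ is splitting if for each $A\in[\mathbb N]^{\aleph_0}$ there is $B\in Y$ such that $A\cap B$ and $A\setminus B$ are both infinite. *)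

theory Defs
  imports "HOL-Analysis.Analysis"
begin

unbundle cardinal_syntax

section \<open>Topologies\<close>

definition baire_space :: "(nat \<Rightarrow> nat) topology" where
  "baire_space = product_topology (\<lambda>_. discrete_topology UNIV) UNIV"

text \<open>The power set of the naturals with the topology transported from the product of
  two-point discrete spaces by characteristic functions.\<close>

definition power_nat :: "nat set topology" where
  "power_nat = pullback_topology UNIV (\<lambda>A n. n \<in> A)
     (product_topology (\<lambda>_. discrete_topology (UNIV :: bool set)) UNIV)"

definition nowhere_dense_in :: "'a topology \<Rightarrow> 'a set \<Rightarrow> bool" where
  "nowhere_dense_in T A \<longleftrightarrow> A \<subseteq> topspace T \<and> T interior_of (T closure_of A) = {}"

definition meager_in :: "'a topology \<Rightarrow> 'a set \<Rightarrow> bool" where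
  "meager_in T A \<longleftrightarrow> (\<exists>N. countable N \<and> (\<forall>B\<in>N. nowhere_dense_in T B) \<and> A = \<Union>N)"

definition finite_power :: "'a topology \<Rightarrow> nat \<Rightarrow> (nat \<Rightarrow> 'a) topology" where
  "finite_power T k = product_topology (\<lambda>_. T) {..<k}"

section \<open>Semifilters and filters\<close>

definition infinite_sets :: "nat set set" where
  "infinite_sets = {A. infinite A}"

definition infinite_coinfinite_sets :: "nat set set" where
  "infinite_coinfinite_sets = {A. infinite A \<and> infinite (- A)}"

definition finite_sets :: "nat set set" where
  "finite_sets = {A. finite A}"

definition almost_subset :: "nat set \<Rightarrow> nat set \<Rightarrow> bool" where
  "almost_subset A B \<longleftrightarrow> finite (A - B)"

definition semifilter :: "nat set set \<Rightarrow> bool" where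
  "semifilter \<F> \<longleftrightarrow> \<F> \<noteq> {} \<and> \<F> \<subseteq> infinite_sets \<and>
     (\<forall>A\<in>\<F>. \<forall>B. almost_subset A B \<longrightarrow> B \<in> \<F>)"

text \<open>Not the type constructor \<open>filter\<close> of the library: the members are infinite sets, so these are
  proper filters, and all cofinite sets are members.\<close>

definition nat_filter :: "nat set set \<Rightarrow> bool" where
  "nat_filter \<F> \<longleftrightarrow> semifilter \<F> \<and> (\<forall>A\<in>\<F>. \<forall>B\<in>\<F>. A \<inter> B \<in> \<F>)"

section \<open>Boundedness\<close>

definition le_on :: "nat set set \<Rightarrow> (nat \<Rightarrow> nat) \<Rightarrow> (nat \<Rightarrow> nat) \<Rightarrow> bool" where
  "le_on \<F> f g \<longleftrightarrow> {n. f n \<le> g n} \<in> \<F>"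

definition le_star :: "(nat \<Rightarrow> nat) \<Rightarrow> (nat \<Rightarrow> nat) \<Rightarrow> bool" where
  "le_star f g \<longleftrightarrow> (\<forall>\<^sub>\<infinity>n. f n \<le> g n)"

definition bounded_wrt ::
    "((nat \<Rightarrow> nat) \<Rightarrow> (nat \<Rightarrow> nat) \<Rightarrow> bool) \<Rightarrow> (nat \<Rightarrow> nat) set \<Rightarrow> bool" where
  "bounded_wrt R Y \<longleftrightarrow> (\<exists>g. \<forall>f\<in>Y. R f g)"

definition dominating :: "(nat \<Rightarrow> nat) set \<Rightarrow> bool" where
  "dominating D \<longleftrightarrow> (\<forall>g. \<exists>f\<in>D. le_star g f)"

definition B_property :: "nat set set \<Rightarrow> 'a topology \<Rightarrow> bool" where
  "B_property \<F> T \<longleftrightarrow>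
     (\<forall>\<phi>. continuous_map T baire_space \<phi> \<longrightarrow> bounded_wrt (le_on \<F>) (\<phi> ` topspace T))"

section \<open>Cardinal characteristics\<close>

text \<open>The least cardinality of a set satisfying \<open>P\<close>, as a cardinal order, i.e.\ a well-order of
  minimal length on its field. The field plays the role of the set of ordinals below that cardinal.\<close>

definition min_card :: "('a set \<Rightarrow> bool) \<Rightarrow> 'a rel" where
  "min_card P = |SOME A. P A \<and> (\<forall>B. P B \<longrightarrow> |A| \<le>o |B| )|"

lemma Card_order_min_card: "Card_order (min_card P)"
  unfolding min_card_def by (rule card_of_Card_order)

lemma min_card_witness:
  assumes "P A"
  shows "\<exists>B. P B \<and> min_card P = |B| \<and> (\<forall>C. P C \<longrightarrow> |B| \<le>o |C| )"
proof -
  let ?R = "card_of ` {A. P A}"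
  have "?R \<noteq> {}" using assms by blast
  moreover have "\<forall>r\<in>?R. Well_order r" by (auto intro: card_of_Well_order)
  ultimately obtain r where "r \<in> ?R" "\<forall>r'\<in>?R. r \<le>o r'"
    using exists_minim_Well_order[of ?R] by blast
  then have "\<exists>B. P B \<and> (\<forall>C. P C \<longrightarrow> |B| \<le>o |C| )" by auto
  from someI_ex[OF this] show ?thesis unfolding min_card_def by blast
qed

definition \<dd> :: "(nat \<Rightarrow> nat) rel" where
  "\<dd> = min_card dominating"

definition \<bb> :: "nat set set \<Rightarrow> (nat \<Rightarrow> nat) rel" where
  "\<bb> \<F> = min_card (\<lambda>Y. \<not> bounded_wrt (le_on \<F>) Y)"

lemma dominating_UNIV: "dominating UNIV"
  unfolding dominating_def le_star_def
proof (intro allI)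
  fix g :: "nat \<Rightarrow> nat"
  show "\<exists>f\<in>UNIV. \<forall>\<^sub>\<infinity>n. g n \<le> f n" by (rule bexI[of _ g]) auto
qed

lemma unbounded_UNIV:
  assumes "semifilter \<F>"
  shows "\<not> bounded_wrt (le_on \<F>) UNIV"
proof
  assume "bounded_wrt (le_on \<F>) UNIV"
  then obtain g where "\<And>f. le_on \<F> f g" by (auto simp: bounded_wrt_def)
  from this[of "\<lambda>n. Suc (g n)"] have "{} \<in> \<F>" by (simp add: le_on_def)
  with assms show False by (auto simp: semifilter_def infinite_sets_def)
qed

text \<open>The index order \<open>r\<close> may be any cardinal order of cardinality \<open>\<bb> \<F>\<close>; all of these are isomorphic
  as well-orders. It is reflexive, so \<open>(\<alpha>, \<beta>) \<in> r\<close> reads \<open>\<alpha> \<le> \<beta>\<close>.\<close>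

definition cofinal_b_scale ::
    "nat set set \<Rightarrow> 'i rel \<Rightarrow> ('i \<Rightarrow> nat \<Rightarrow> nat) \<Rightarrow> bool" where
  "cofinal_b_scale \<F> r f \<longleftrightarrow>
     Card_order r \<and> r =o \<bb> \<F> \<and>
     (\<forall>\<alpha>\<in>Field r. strict_mono (f \<alpha>)) \<and>
     (\<forall>\<alpha> \<beta>. (\<alpha>, \<beta>) \<in> r \<and> \<alpha> \<noteq> \<beta> \<longrightarrow> le_on \<F> (f \<alpha>) (f \<beta>)) \<and>
     (\<forall>g. \<exists>\<alpha>\<in>Field r. \<forall>\<beta>. (\<alpha>, \<beta>) \<in> r \<longrightarrow> le_on \<F> g (f \<beta>))"

section \<open>Splitting families\<close>

definition splitting :: "nat set set \<Rightarrow> bool" where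
  "splitting Y \<longleftrightarrow>
     (\<forall>A\<in>infinite_sets. \<exists>B\<in>Y. infinite (A \<inter> B) \<and> infinite (A - B))"

end

theory Submission
  imports Defs
begin

text \<open>The scale is built by recursion along a dominating family \<open>D\<close> of cardinality \<open>\<dd> = \<bb>(\<F>)\<close>. At
  stage \<open>d \<in> D\<close> the earlier members together with \<open>d\<close> are bounded by some \<open>g\<close> with respect to
  \<open>\<le>\<^sub>\<F>\<close>. Because \<open>\<F>\<close> is nonmeager, some member of \<open>\<F>\<close> misses infinitely many blocks of any given
  sequence of disjoint intervals; on those blocks the new set may be enumerated by consecutive
  numbers without violating \<open>g \<le>\<^sub>\<F> a\<close>, while elsewhere it grows fast. So \<open>a\<close> contains, and misses,
  infinitely many intervals \<open>[p, p + d(p)]\<close>. Containing and missing them makes the family split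
  every infinite \<open>A\<close> whose distance-to-next-element function is below \<open>d\<close>, and containing them
  makes the complement of \<open>a\<close> exceed \<open>d\<close> infinitely often.

  For the finite powers, let \<open>\<phi>\<close> be continuous on \<open>X\<^sup>I\<close>. By continuity at the tuples of finite
  sets, \<open>\<phi>(x)(n)\<close> is bounded as soon as all coordinates of \<open>x\<close> omit a common sufficiently long
  interval, and by the pigeonhole principle this happens when all \<open>x\<^sub>i(n)\<close> are large. This bounds
  \<open>\<phi>\<close> on the tuples with all coordinates late in the scale; the other tuples lie in fewer than
  \<open>\<bb>(\<F>)\<close> (together with countably many) slices, which are handled by induction on \<open>I\<close>.\<close>

section \<open>The topology of the power set\<close>

lemma topspace_power_nat [simp]: "topspace power_nat = UNIV"
  by (simp add: power_nat_def topspace_pullback_topology)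

text \<open>A basic open set of the product constrains finitely many coordinates, and these all lie
  below one \<open>N\<close>. All later topological arguments compare initial segments only.\<close>

lemma openin_power_nat:
  "openin power_nat V \<longleftrightarrow> (\<forall>q\<in>V. \<exists>N. \<forall>x. x \<inter> {..<N} = q \<inter> {..<N} \<longrightarrow> x \<in> V)"
proof
  assume "openin power_nat V"
  then obtain W where W: "openin (product_topology (\<lambda>_. discrete_topology (UNIV :: bool set)) UNIV) W"
    and V: "V = (\<lambda>A n. n \<in> A) -` W"
    by (auto simp: power_nat_def openin_pullback_topology)
  show "\<forall>q\<in>V. \<exists>N. \<forall>x. x \<inter> {..<N} = q \<inter> {..<N} \<longrightarrow> x \<in> V"
  proof
    fix q assume "q \<in> V"
    then have "(\<lambda>n. n \<in> q) \<in> W" using V by auto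
    then obtain U :: "nat \<Rightarrow> bool set" where U: "finite {n. U n \<noteq> UNIV}" "\<And>n. (n \<in> q) \<in> U n"
      "\<And>x. (\<forall>n. x n \<in> U n) \<Longrightarrow> x \<in> W"
      using W by (fastforce simp: openin_product_topology_alt Pi_iff)
    then obtain N where N: "\<And>n. U n \<noteq> UNIV \<Longrightarrow> n < N"
      by (auto simp: finite_nat_iff_bounded subset_iff)
    have "x \<in> V" if x: "x \<inter> {..<N} = q \<inter> {..<N}" for x
    proof -
      have "(n \<in> x) \<in> U n" for n
      proof (cases "n < N")
        case True
        then have "n \<in> x \<longleftrightarrow> n \<in> q" using x by blast
        then show ?thesis using U(2) by simp
      next
        case False
        then show ?thesis using N by blast
      qed
      then show ?thesis using U(3)[of "\<lambda>n. n \<in> x"] by (auto simp: V)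
    qed
    then show "\<exists>N. \<forall>x. x \<inter> {..<N} = q \<inter> {..<N} \<longrightarrow> x \<in> V" by blast
  qed
next
  assume *: "\<forall>q\<in>V. \<exists>N. \<forall>x. x \<inter> {..<N} = q \<inter> {..<N} \<longrightarrow> x \<in> V"
  let ?W = "{f. {n. f n} \<in> V}"
  have "openin (product_topology (\<lambda>_. discrete_topology (UNIV :: bool set)) UNIV) ?W"
    unfolding openin_product_topology_alt
  proof
    fix f assume "f \<in> ?W"
    then obtain N where N: "\<And>x. x \<inter> {..<N} = {n. f n} \<inter> {..<N} \<Longrightarrow> x \<in> V" using * by blast
    let ?U = "\<lambda>n. if n < N then {f n} else (UNIV :: bool set)"
    have "finite {n \<in> UNIV. ?U n \<noteq> topspace (discrete_topology UNIV)}"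
      by (rule finite_subset[of _ "{..<N}"]) auto
    moreover have "Pi\<^sub>E UNIV ?U \<subseteq> ?W"
    proof
      fix h assume "h \<in> Pi\<^sub>E UNIV ?U"
      then have "h n = f n" if "n < N" for n using that PiE_mem[of h UNIV ?U n] by simp
      then show "h \<in> ?W" using N[of "{n. h n}"] by auto
    qed
    ultimately show "\<exists>U. finite {i \<in> UNIV. U i \<noteq> topspace (discrete_topology (UNIV :: bool set))} \<and>
        (\<forall>i\<in>UNIV. openin (discrete_topology UNIV) (U i)) \<and> f \<in> Pi\<^sub>E UNIV U \<and> Pi\<^sub>E UNIV U \<subseteq> ?W"
      by (intro exI[of _ ?U]) auto
  qed
  moreover have "V = (\<lambda>A n. n \<in> A) -` ?W \<inter> UNIV" by auto
  ultimately show "openin power_nat V" unfolding power_nat_def openin_pullback_topology by blast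
qed

lemma openin_power_nat_cylinder: "openin power_nat {x. x \<inter> {..<N} = s}"
  unfolding openin_power_nat by blast

lemma homeomorphic_map_uminus_power_nat: "homeomorphic_map power_nat power_nat uminus"
proof -
  have "continuous_map power_nat power_nat uminus"
    unfolding continuous_map_def
  proof (intro conjI allI impI)
    fix U assume "openin power_nat U"
    then have U: "\<exists>N. \<forall>x. x \<inter> {..<N} = q \<inter> {..<N} \<longrightarrow> x \<in> U" if "q \<in> U" for q
      using that by (simp add: openin_power_nat)
    have "\<exists>N. \<forall>x. x \<inter> {..<N} = q \<inter> {..<N} \<longrightarrow> - x \<in> U" if q: "- q \<in> U" for q
    proof -
      obtain N where N: "\<And>x. x \<inter> {..<N} = - q \<inter> {..<N} \<Longrightarrow> x \<in> U" using U[OF q] by blast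
      have "- x \<in> U" if "x \<inter> {..<N} = q \<inter> {..<N}" for x
        by (rule N) (use that in blast)
      then show ?thesis by blast
    qed
    then show "openin power_nat {x \<in> topspace power_nat. - x \<in> U}"
      by (simp add: openin_power_nat)
  qed auto
  then have "homeomorphic_maps power_nat power_nat uminus uminus"
    by (simp add: homeomorphic_maps_def)
  then show ?thesis by (auto simp: homeomorphic_map_maps)
qed

text \<open>Since \<open>I\<close> is finite, the largest of the coordinatewise thresholds serves
  every coordinate at once.\<close>

lemma product_power_nat_nbhd:
  assumes I: "finite I" and W: "openin (product_topology (\<lambda>_. subtopology power_nat X) I) W"
    and q: "q \<in> W"
  obtains N where "\<And>x. x \<in> Pi\<^sub>E I (\<lambda>_. X) \<Longrightarrow> \<forall>i\<in>I. x i \<inter> {..<N} = q i \<inter> {..<N} \<Longrightarrow> x \<in> W"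
proof -
  obtain U where U: "\<And>i. i \<in> I \<Longrightarrow> openin (subtopology power_nat X) (U i)"
    "q \<in> Pi\<^sub>E I U" "Pi\<^sub>E I U \<subseteq> W"
    using W q unfolding openin_product_topology_alt by meson
  have "\<exists>N. \<forall>x\<in>X. x \<inter> {..<N} = q i \<inter> {..<N} \<longrightarrow> x \<in> U i" if i: "i \<in> I" for i
  proof -
    obtain V where V: "openin power_nat V" "U i = V \<inter> X"
      using U(1)[OF i] by (auto simp: openin_subtopology)
    moreover have "q i \<in> V" using U(2) i V(2) by (auto simp: PiE_iff)
    ultimately obtain N where "\<forall>x. x \<inter> {..<N} = q i \<inter> {..<N} \<longrightarrow> x \<in> V"
      unfolding openin_power_nat by blast
    then show ?thesis using V(2) by blast
  qed
  then obtain M where M: "\<And>i x. i \<in> I \<Longrightarrow> x \<in> X \<Longrightarrow> x \<inter> {..<M i} = q i \<inter> {..<M i} \<Longrightarrow> x \<in> U i"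
    by metis
  \<comment> \<open>Inserting 0 keeps the maximum meaningful for empty \<open>I\<close>.\<close>
  define N where "N = Max (insert 0 (M ` I))"
  have MN: "M i \<le> N" if "i \<in> I" for i using I that by (simp add: N_def)
  show ?thesis
  proof (rule that)
    fix x assume x: "x \<in> Pi\<^sub>E I (\<lambda>_. X)" "\<forall>i\<in>I. x i \<inter> {..<N} = q i \<inter> {..<N}"
    have "x i \<in> U i" if i: "i \<in> I" for i
    proof (rule M[OF i])
      show "x i \<inter> {..<M i} = q i \<inter> {..<M i}"
        using x(2) i MN[OF i] by (auto simp: set_eq_iff) (metis order_less_le_trans)+
    qed (use x i in auto)
    then have "x \<in> Pi\<^sub>E I U" using x(1) by (simp add: PiE_iff)
    then show "x \<in> W" using U(3) by blast
  qed
qed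

text \<open>The easy half of Talagrand's characterization. If every member of \<F> met almost all
  blocks, \<F> would be the union of the sets \<open>C N\<close>; each of these is nowhere dense,
  because a finite trace can be continued by a block containing no element.\<close>

lemma nonmeager_misses_blocks:
  assumes nm: "\<not> meager_in power_nat \<F>" and k: "strict_mono (k :: nat \<Rightarrow> nat)"
  obtains B where "B \<in> \<F>" "\<exists>\<^sub>\<infinity>n. B \<inter> {k n..<k (Suc n)} = {}"
proof -
  define C where "C = (\<lambda>N. {B \<in> \<F>. \<forall>n\<ge>N. B \<inter> {k n..<k (Suc n)} \<noteq> {}})"
  have "nowhere_dense_in power_nat (C N)" for N
  proof -
    have False if q: "q \<in> power_nat interior_of (power_nat closure_of C N)" for q
    proof -
      obtain U where U: "openin power_nat U" "q \<in> U" "U \<subseteq> power_nat closure_of C N"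
        using q unfolding interior_of_def by blast
      then obtain m where m: "\<And>x. x \<inter> {..<m} = q \<inter> {..<m} \<Longrightarrow> x \<in> U"
        unfolding openin_power_nat by blast
      \<comment> \<open>Block \<open>?n\<close> starts at or after \<open>m\<close> because
        \<open>k ?n\<close> is at least \<open>?n\<close>. Hence \<open>?x\<close> has no element
        there, and neither has any \<open>y\<close> agreeing with \<open>?x\<close> up to the end of
        that block.\<close>
      let ?n = "max N m"
      let ?x = "q \<inter> {..<m}"
      let ?W = "{y. y \<inter> {..<k (Suc ?n)} = ?x \<inter> {..<k (Suc ?n)}}"
      have "?x \<in> power_nat closure_of C N" using m[of ?x] U(3) by auto
      then have "\<forall>T. ?x \<in> T \<and> openin power_nat T \<longrightarrow> (\<exists>y. y \<in> C N \<and> y \<in> T)"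
        by (simp add: in_closure_of)
      then have "?x \<in> ?W \<and> openin power_nat ?W \<longrightarrow> (\<exists>y. y \<in> C N \<and> y \<in> ?W)" by (rule spec)
      moreover have "?x \<in> ?W" by simp
      moreover note openin_power_nat_cylinder[of "k (Suc ?n)" "?x \<inter> {..<k (Suc ?n)}"]
      ultimately have "\<exists>y. y \<in> C N \<and> y \<in> ?W" by blast
      then obtain y where y: "y \<in> C N" "y \<in> ?W" by blast
      have "m \<le> k ?n" using strict_mono_imp_increasing[OF k, of ?n] by linarith
      have "z \<notin> y" if z: "k ?n \<le> z" "z < k (Suc ?n)" for z
      proof
        assume "z \<in> y"
        then have "z \<in> ?x \<inter> {..<k (Suc ?n)}" using y(2) z(2) by blast
        then show False using z(1) \<open>m \<le> k ?n\<close> by simp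
      qed
      then have "y \<inter> {k ?n..<k (Suc ?n)} = {}" by fastforce
      moreover have "N \<le> ?n" by simp
      ultimately show False using y(1) unfolding C_def by blast
    qed
    then show ?thesis by (auto simp: nowhere_dense_in_def)
  qed
  moreover have "countable (range C)" by simp
  ultimately have "\<F> \<noteq> \<Union> (range C)" using nm unfolding meager_in_def by blast
  moreover have "\<Union> (range C) \<subseteq> \<F>" by (auto simp: C_def)
  ultimately obtain B where "B \<in> \<F>" "\<And>N. B \<notin> C N" by blast
  then show ?thesis
    using that[of B] unfolding C_def INFM_nat_le by auto
qed

section \<open>Enumerations and gaps\<close>

text \<open>With the converse that follows, this translates growth of an enumeration into counting
  the elements below a point.\<close>

lemma enumerate_ge:
  fixes A :: "nat set"
  assumes "infinite A" "card (A \<inter> {..<x}) \<le> n"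
  shows "x \<le> enumerate A n"
proof (rule ccontr)
  assume "\<not> x \<le> enumerate A n"
  then have "enumerate A ` {..n} \<subseteq> A \<inter> {..<x}"
    using assms(1) by (auto simp: enumerate_in_set) (metis enumerate_mono_le_iff not_le order_le_less_trans)
  then have "card (enumerate A ` {..n}) \<le> card (A \<inter> {..<x})" by (intro card_mono) auto
  moreover have "card (enumerate A ` {..n}) = Suc n"
    by (subst card_image) (use assms(1) inj_enumerate in \<open>auto intro: inj_on_subset\<close>)
  ultimately show False using assms(2) by simp
qed

lemma card_below_enumerate:
  fixes A :: "nat set"
  assumes "infinite A" "x \<le> enumerate A n"
  shows "card (A \<inter> {..<x}) \<le> n"
proof -
  have "A \<inter> {..<x} \<subseteq> enumerate A ` {..<n}"
  proof
    fix s assume s: "s \<in> A \<inter> {..<x}"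
    then obtain k where k: "enumerate A k = s" using enumerate_Ex assms(1) by blast
    then have "enumerate A k < enumerate A n" using s assms(2) by auto
    then have "k < n" using assms(1) by simp
    then show "s \<in> enumerate A ` {..<n}" using k by blast
  qed
  then have "card (A \<inter> {..<x}) \<le> card (enumerate A ` {..<n})" by (intro card_mono) auto
  then show ?thesis using card_image_le[of "{..<n}" "enumerate A"] by simp
qed

lemma enumerate_range:
  fixes f :: "nat \<Rightarrow> nat"
  assumes f: "strict_mono f"
  shows "enumerate (range f) = f"
proof
  fix n
  have inf: "infinite (range f)" using f by (simp add: range_inj_infinite strict_mono_imp_inj_on)
  have "range f \<inter> {..<f n} \<subseteq> f ` {..<n}" using f by (auto simp: strict_mono_less)
  then have "card (range f \<inter> {..<f n}) \<le> card (f ` {..<n})" by (intro card_mono) auto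
  also have "\<dots> \<le> n" using card_image_le[of "{..<n}" f] by simp
  finally have "f n \<le> enumerate (range f) n" using inf by (rule enumerate_ge[rotated])
  moreover have "\<not> f n < enumerate (range f) n"
  proof
    assume "f n < enumerate (range f) n"
    then have "card (range f \<inter> {..<Suc (f n)}) \<le> n"
      using inf by (intro card_below_enumerate) auto
    moreover have "f ` {..n} \<subseteq> range f \<inter> {..<Suc (f n)}"
      using f by (auto simp: strict_mono_less_eq less_Suc_eq_le)
    then have "card (f ` {..n}) \<le> card (range f \<inter> {..<Suc (f n)})" by (intro card_mono) auto
    moreover have "card (f ` {..n}) = Suc n"
      using f by (subst card_image) (auto intro: strict_mono_imp_inj_on inj_on_subset)
    ultimately show False by simp
  qed
  ultimately show "enumerate (range f) n = f n" by simp
qed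

text \<open>Pigeonhole: each \<open>A i\<close> has at most \<open>n\<close> elements below
  \<open>m (Suc (card I * n))\<close>, so all the sets together meet at most
  \<open>card I * n\<close> of the \<open>card I * n + 1\<close> disjoint intervals.\<close>

lemma common_gap:
  fixes m :: "nat \<Rightarrow> nat" and A :: "'i \<Rightarrow> nat set"
  assumes m: "strict_mono m" and I: "finite I" and inf: "\<And>i. i \<in> I \<Longrightarrow> infinite (A i)"
    and large: "\<And>i. i \<in> I \<Longrightarrow> m (Suc (card I * n)) \<le> enumerate (A i) n"
  shows "\<exists>j\<le>card I * n. \<forall>i\<in>I. A i \<inter> {m j..<m (Suc j)} = {}"
proof (rule ccontr)
  let ?K = "card I * n"
  \<comment> \<open>The possible hits are pairs of an index and an element. If no interval were
    free, \<open>p\<close> would choose a hit in each, injectively because the elements increase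
    with the interval.\<close>
  let ?S = "SIGMA i:I. A i \<inter> {..<m (Suc ?K)}"
  assume "\<not> ?thesis"
  then have "\<forall>j\<in>{..?K}. \<exists>p. fst p \<in> I \<and> snd p \<in> A (fst p) \<and> m j \<le> snd p \<and> snd p < m (Suc j)"
    by fastforce
  then obtain p where p: "\<And>j. j \<le> ?K \<Longrightarrow>
      fst (p j) \<in> I \<and> snd (p j) \<in> A (fst (p j)) \<and> m j \<le> snd (p j) \<and> snd (p j) < m (Suc j)"
    by (metis atMost_iff)
  have less: "snd (p j) < snd (p j')" if "j < j'" "j' \<le> ?K" for j j'
  proof -
    have "m (Suc j) \<le> m j'" using m that by (simp add: strict_mono_less_eq)
    then show ?thesis using p[of j] p[of j'] that by linarith
  qed
  have "inj_on p {..?K}"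
    by (rule linorder_inj_onI) (use less in force, auto)
  moreover have "p ` {..?K} \<subseteq> ?S"
  proof
    fix s assume "s \<in> p ` {..?K}"
    then obtain j where j: "s = p j" "j \<le> ?K" by blast
    then have "m (Suc j) \<le> m (Suc ?K)" using m by (simp add: strict_mono_less_eq)
    then show "s \<in> ?S" using p[OF j(2)] j(1) by (auto simp: mem_Sigma_iff mem_Times_iff Sigma_def prod_eq_iff)
  qed
  moreover have "finite ?S" using I by auto
  ultimately have "card {..?K} \<le> card ?S" by (intro card_inj_on_le)
  also have "\<dots> = (\<Sum>i\<in>I. card (A i \<inter> {..<m (Suc ?K)}))" using I by simp
  also have "\<dots> \<le> (\<Sum>i\<in>I. n)"
    by (intro sum_mono card_below_enumerate inf large)
  finally show False by simp
qed

section \<open>Boundedness modulo a filter\<close>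

lemma semifilter_mono:
  assumes "semifilter \<F>" "A \<in> \<F>" "A \<subseteq> B"
  shows "B \<in> \<F>"
proof -
  have "almost_subset A B" using assms(3) by (simp add: almost_subset_def Diff_eq_empty_iff[THEN iffD2])
  then show ?thesis using assms(1,2) unfolding semifilter_def by blast
qed

lemma le_on_le:
  assumes "semifilter \<F>" "le_on \<F> f g" "\<And>n. f' n \<le> f n" "\<And>n. g n \<le> g' n"
  shows "le_on \<F> f' g'"
  using assms(1,2) unfolding le_on_def
proof (rule semifilter_mono)
  show "{n. f n \<le> g n} \<subseteq> {n. f' n \<le> g' n}"
  proof
    fix n assume "n \<in> {n. f n \<le> g n}"
    then show "n \<in> {n. f' n \<le> g' n}" using assms(3)[of n] assms(4)[of n] by simp
  qed
qed

lemma le_on_trans: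
  assumes \<F>: "nat_filter \<F>" and "le_on \<F> f g" "le_on \<F> g h"
  shows "le_on \<F> f h"
proof -
  have "{n. f n \<le> g n} \<inter> {n. g n \<le> h n} \<in> \<F>"
    using assms unfolding nat_filter_def le_on_def by blast
  then show ?thesis unfolding le_on_def
    by (rule semifilter_mono[rotated]) (use \<F> in \<open>auto simp: nat_filter_def\<close>)
qed

lemma nat_filter_INT:
  assumes \<F>: "nat_filter \<F>" and I: "finite I" and A: "\<And>i. i \<in> I \<Longrightarrow> A i \<in> \<F>"
  shows "{n. \<forall>i\<in>I. n \<in> A i} \<in> \<F>"
  using I A
proof (induction I rule: finite_induct)
  case empty
  obtain B where "B \<in> \<F>" using \<F> unfolding nat_filter_def semifilter_def by blast
  then have "UNIV \<in> \<F>" by (rule semifilter_mono[rotated]) (use \<F> in \<open>auto simp: nat_filter_def\<close>)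
  then show ?case by simp
next
  case (insert i I)
  then have "A i \<inter> {n. \<forall>i\<in>I. n \<in> A i} \<in> \<F>" using \<F> unfolding nat_filter_def by blast
  moreover have "A i \<inter> {n. \<forall>i\<in>I. n \<in> A i} = {n. \<forall>j\<in>insert i I. n \<in> A j}" by auto
  ultimately show ?case by simp
qed

lemma le_star_imp_le_on:
  assumes \<F>: "semifilter \<F>" and "le_star f g"
  shows "le_on \<F> f g"
proof -
  obtain A where "A \<in> \<F>" using \<F> unfolding semifilter_def by blast
  moreover have "almost_subset A {n. f n \<le> g n}"
    unfolding almost_subset_def
    by (rule finite_subset[of _ "{n. \<not> f n \<le> g n}"])
      (use assms(2) in \<open>auto simp: le_star_def MOST_iff_finiteNeg\<close>)
  ultimately show ?thesis using \<F> unfolding semifilter_def le_on_def by blast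
qed

text \<open>Diagonal bound: at \<open>n\<close>, the sum takes in the functions with index up to
  \<open>n\<close>, so it is above the function with index \<open>i\<close> from \<open>i\<close>
  on.\<close>

lemma bounded_wrt_countable:
  assumes \<F>: "semifilter \<F>" and Y: "countable Y"
  shows "bounded_wrt (le_on \<F>) Y"
  unfolding bounded_wrt_def
proof (intro exI ballI)
  let ?g = "\<lambda>n. \<Sum>i\<le>n. from_nat_into Y i n"
  fix f assume "f \<in> Y"
  then obtain i where i: "f = from_nat_into Y i" using Y by (metis from_nat_into_surj)
  have "le_star f ?g"
    unfolding le_star_def MOST_nat_le
    by (intro exI[of _ i] allI impI) (auto simp: i intro: member_le_sum)
  then show "le_on \<F> f ?g" using \<F> by (rule le_star_imp_le_on[rotated])
qed

lemma bounded_wrt_Un: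
  assumes \<F>: "semifilter \<F>" and "bounded_wrt (le_on \<F>) Y" "bounded_wrt (le_on \<F>) Z"
  shows "bounded_wrt (le_on \<F>) (Y \<union> Z)"
proof -
  obtain g h where gh: "\<And>f. f \<in> Y \<Longrightarrow> le_on \<F> f g" "\<And>f. f \<in> Z \<Longrightarrow> le_on \<F> f h"
    using assms by (auto simp: bounded_wrt_def)
  have "le_on \<F> f (\<lambda>n. max (g n) (h n))" if "f \<in> Y \<union> Z" for f
    using that le_on_le[OF \<F> gh(1), of f f] le_on_le[OF \<F> gh(2), of f f] by auto
  then show ?thesis by (auto simp: bounded_wrt_def)
qed

lemma bounded_wrt_small:
  assumes \<F>: "semifilter \<F>" and Y: "|Y| <o \<bb> \<F>"
  shows "bounded_wrt (le_on \<F>) Y"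
proof (rule ccontr)
  assume "\<not> bounded_wrt (le_on \<F>) Y"
  moreover obtain B where "\<bb> \<F> = |B|" "\<And>C. \<not> bounded_wrt (le_on \<F>) C \<Longrightarrow> |B| \<le>o |C|"
    using min_card_witness[of "\<lambda>Y. \<not> bounded_wrt (le_on \<F>) Y", OF unbounded_UNIV[OF \<F>]]
    unfolding \<bb>_def by blast
  ultimately have "\<bb> \<F> \<le>o |Y|" by simp
  then show False using Y not_ordLess_ordLeq by blast
qed

section \<open>The scale\<close>

lemma exists_block_set:
  fixes d g :: "nat \<Rightarrow> nat"
  assumes \<F>: "semifilter \<F>" and nm: "\<not> meager_in power_nat \<F>"
  obtains a where "infinite a" "infinite (- a)" "le_on \<F> g (enumerate a)"
    "\<exists>\<^sub>\<infinity>p. {p..p + d p} \<subseteq> a" "\<exists>\<^sub>\<infinity>p. {p..p + d p} \<inter> a = {}"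
proof -
  text \<open>The enumeration of \<open>a\<close> jumps above \<open>g\<close> at every index, leaving a gap \<open>{p..p + d p}\<close>, except
    along the runs indexed by \<open>J\<close>. Since \<open>J\<close> is chosen after \<open>k\<close>, the lengths of the blocks between
    consecutive values of \<open>k\<close> are computed from a bound \<open>u\<close> on the enumeration which does not
    depend on \<open>J\<close>.\<close>
  define e where "e = (\<lambda>m x. max (g (Suc m)) (Suc (Suc x + d (Suc x))))"
  \<comment> \<open>Here and in \<open>k\<close>, a sum over all values up to the bound acts as a
    maximum, since neither \<open>e m\<close> nor \<open>d\<close> need be monotone.\<close>
  define u where "u = rec_nat (g 0) (\<lambda>m y. y + (\<Sum>x\<le>y. Suc (e m x)))"
  define k where "k = rec_nat 0 (\<lambda>_ y. Suc (y + (\<Sum>x\<le>u y. d x)))"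
  have u: "u 0 = g 0" "\<And>m. u (Suc m) = u m + (\<Sum>x\<le>u m. Suc (e m x))" by (auto simp: u_def)
  have k: "\<And>n. k (Suc n) = Suc (k n + (\<Sum>x\<le>u (k n). d x))" by (auto simp: k_def)
  have mono_k: "strict_mono k" by (simp add: strict_mono_Suc_iff k)
  obtain B where B: "B \<in> \<F>" "\<exists>\<^sub>\<infinity>n. B \<inter> {k n..<k (Suc n)} = {}"
    using nonmeager_misses_blocks[OF nm mono_k] .
  define M where "M = {n. B \<inter> {k n..<k (Suc n)} = {}}"
  have infM: "infinite M" using B(2) by (simp add: M_def INFM_iff_infinite)
  \<comment> \<open>The left endpoints \<open>k n\<close> stay outside \<open>J\<close>:
    \<open>f\<close> jumps at each positive one, which yields the gaps, and the runs start from
    there. \<open>B\<close> is disjoint from \<open>J\<close>, so \<open>f\<close> is above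
    \<open>g\<close> on \<open>B\<close>.\<close>
  define J where "J = (\<Union>n\<in>M. {k n<..<k (Suc n)})"
  define f where "f = rec_nat (g 0) (\<lambda>m y. if Suc m \<in> J then Suc y else e m y)"
  have f0: "f 0 = g 0" and f_in: "\<And>m. Suc m \<in> J \<Longrightarrow> f (Suc m) = Suc (f m)"
    and f_out: "\<And>m. Suc m \<notin> J \<Longrightarrow> f (Suc m) = e m (f m)"
    by (auto simp: f_def)
  have e_gt: "Suc x + d (Suc x) < e m x" "g (Suc m) \<le> e m x" for m x by (auto simp: e_def)
  have "f m < f (Suc m)" for m
    using e_gt(1)[of "f m" m] f_in[of m] f_out[of m] by (cases "Suc m \<in> J") auto
  then have mono_f: "strict_mono f" by (simp add: strict_mono_Suc_iff)
  have f_le_u: "f m \<le> u m" for m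
  proof (induction m)
    case 0
    then show ?case by (simp add: f0 u)
  next
    case (Suc m)
    have "Suc (e m (f m)) \<le> (\<Sum>x\<le>u m. Suc (e m x))"
      using Suc by (intro member_le_sum) auto
    then show ?case using e_gt(1)[of "f m" m] f_in[of m] f_out[of m] u(2)[of m]
      by (cases "Suc m \<in> J") auto
  qed
  have k_notin_J: "k n \<notin> J" for n
  proof
    assume "k n \<in> J"
    then obtain n' where "k n' < k n" "k n < k (Suc n')" by (auto simp: J_def)
    then have "n' < n" "n < Suc n'" using mono_k by (simp_all add: strict_mono_less)
    then show False by simp
  qed
  have run: "f (k n + i) = f (k n) + i" if "n \<in> M" "k n + i < k (Suc n)" for n i
    using that(2)
  proof (induction i)
    case 0
    then show ?case by simp
  next
    case (Suc i)
    then have "Suc (k n + i) \<in> J" using that(1) by (force simp: J_def)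
    then show ?case using Suc f_in by simp
  qed
  define a where "a = range f"
  have inf_a: "infinite a" using mono_f by (simp add: a_def range_inj_infinite strict_mono_imp_inj_on)
  have "\<exists>\<^sub>\<infinity>p. {p..p + d p} \<subseteq> a"
    unfolding INFM_nat_le
  proof
    fix N
    obtain n where n: "n \<in> M" "N \<le> n" using infM by (auto simp: infinite_nat_iff_unbounded_le)
    let ?p = "f (k n)"
    have "N \<le> ?p"
      using n(2) strict_mono_imp_increasing[OF mono_k, of n] strict_mono_imp_increasing[OF mono_f, of "k n"]
      by linarith
    moreover have "{?p..?p + d ?p} \<subseteq> a"
    proof
      fix x assume x: "x \<in> {?p..?p + d ?p}"
      have "d ?p \<le> (\<Sum>x\<le>u (k n). d x)" using f_le_u by (intro member_le_sum) auto
      then have "f (k n + (x - ?p)) = ?p + (x - ?p)" using x by (intro run n(1)) (auto simp: k)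
      then show "x \<in> a" using x unfolding a_def by (metis atLeastAtMost_iff le_add_diff_inverse rangeI)
    qed
    ultimately show "\<exists>p\<ge>N. {p..p + d p} \<subseteq> a" by blast
  qed
  moreover have gap: "\<exists>\<^sub>\<infinity>p. {p..p + d p} \<inter> a = {}"
    unfolding INFM_nat_le
  proof
    fix N
    \<comment> \<open>\<open>k (Suc N)\<close> is positive, so it has a predecessor
      \<open>m\<close>; the jump from \<open>f m\<close> to \<open>f (Suc m)\<close> skips the
      interval starting at \<open>Suc (f m)\<close>.\<close>
    obtain m where m: "k (Suc N) = Suc m" "N \<le> m"
      using strict_mono_imp_increasing[OF mono_k, of "Suc N"] by (cases "k (Suc N)") auto
    let ?p = "Suc (f m)"
    have "N \<le> ?p" using m(2) strict_mono_imp_increasing[OF mono_f, of m] by linarith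
    moreover have "?p + d ?p < f (Suc m)"
      using f_out[of m] k_notin_J[of "Suc N"] m(1) e_gt(1) by simp
    then have "{?p..?p + d ?p} \<inter> a = {}"
      using mono_f by (auto simp: a_def Suc_le_eq) (metis not_less_eq order_le_less_trans strict_mono_less)
    ultimately show "\<exists>p\<ge>N. {p..p + d p} \<inter> a = {}" by blast
  qed
  moreover have "infinite (- a)"
    unfolding infinite_nat_iff_unbounded_le
  proof
    fix N
    obtain p where p: "p \<ge> N" "{p..p + d p} \<inter> a = {}" using gap unfolding INFM_nat_le by blast
    have "p \<in> {p..p + d p}" by simp
    then have "p \<in> - a" using p(2) by blast
    then show "\<exists>n\<ge>N. n \<in> - a" using p(1) by blast
  qed
  moreover have "le_on \<F> g (enumerate a)"
    unfolding a_def enumerate_range[OF mono_f] le_on_def using \<F> B(1)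
  proof (rule semifilter_mono)
    have "g n \<le> f n" if "n \<in> B" for n
    proof -
      have "n \<notin> J"
      proof
        assume "n \<in> J"
        then obtain i where "i \<in> M" "n \<in> {k i<..<k (Suc i)}" unfolding J_def by blast
        then have "B \<inter> {k i..<k (Suc i)} = {}" "n \<in> {k i..<k (Suc i)}" by (simp_all add: M_def)
        then show False using that by blast
      qed
      then show ?thesis using f_out e_gt(2) f0 by (cases n) auto
    qed
    then show "B \<subseteq> {n. g n \<le> f n}" by blast
  qed
  ultimately show ?thesis using that inf_a by blast
qed

text \<open>As the field of \<open>\<dd>\<close> is itself a dominating family, the indices also serve as the functions
  to be diagonalized against.\<close>

lemma exists_scale:
  fixes r :: "(nat \<Rightarrow> nat) rel"
  assumes \<F>: "nat_filter \<F>" and nm: "\<not> meager_in power_nat \<F>"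
    and r: "Card_order r" "r =o \<bb> \<F>"
  obtains a where "\<And>\<alpha>. \<alpha> \<in> Field r \<Longrightarrow> infinite (a \<alpha>) \<and> infinite (- a \<alpha>) \<and>
    le_on \<F> \<alpha> (enumerate (a \<alpha>)) \<and>
    (\<exists>\<^sub>\<infinity>p. {p..p + \<alpha> p} \<subseteq> a \<alpha>) \<and> (\<exists>\<^sub>\<infinity>p. {p..p + \<alpha> p} \<inter> a \<alpha> = {}) \<and>
    (\<forall>\<beta>\<in>underS r \<alpha>. le_on \<F> (enumerate (a \<beta>)) (enumerate (a \<alpha>)))"
proof -
  have sf: "semifilter \<F>" using \<F> by (simp add: nat_filter_def)
  \<comment> \<open>As the recursion requires, \<open>?P\<close> reads \<open>f\<close> only at
    strict predecessors of \<alpha>; it is vacuous off the field, so a witness exists at every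
    index.\<close>
  let ?P = "\<lambda>f \<alpha> s. \<alpha> \<in> Field r \<longrightarrow> infinite s \<and> infinite (- s) \<and> le_on \<F> \<alpha> (enumerate s) \<and>
    (\<exists>\<^sub>\<infinity>p. {p..p + \<alpha> p} \<subseteq> s) \<and> (\<exists>\<^sub>\<infinity>p. {p..p + \<alpha> p} \<inter> s = {}) \<and>
    (\<forall>\<beta>\<in>underS r \<alpha>. le_on \<F> (enumerate (f \<beta>)) (enumerate s))"
  have "wf (r - Id)" using r(1) by (simp add: card_order_on_def well_order_on_def)
  moreover have "?P f \<alpha> s = ?P f' \<alpha> s" if "\<And>\<beta>. (\<beta>, \<alpha>) \<in> r - Id \<Longrightarrow> f \<beta> = f' \<beta>" for f f' :: "_ \<Rightarrow> nat set" and \<alpha> s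
    using that by (auto simp: underS_def)
  moreover have "\<exists>s. ?P f \<alpha> s" for f \<alpha>
  proof (cases "\<alpha> \<in> Field r")
    case True
    let ?Y = "(\<lambda>\<beta>. enumerate (f \<beta>)) ` underS r \<alpha>"
    have "|?Y| \<le>o |underS r \<alpha>|" by (rule card_of_image)
    also have "|underS r \<alpha>| <o r" using r(1) True by (rule card_of_underS)
    also have "r =o \<bb> \<F>" by (rule r(2))
    finally have "bounded_wrt (le_on \<F>) ?Y" by (rule bounded_wrt_small[OF sf])
    moreover have "bounded_wrt (le_on \<F>) {\<alpha>}" using sf by (rule bounded_wrt_countable) simp
    ultimately have "bounded_wrt (le_on \<F>) (?Y \<union> {\<alpha>})" by (rule bounded_wrt_Un[OF sf])
    then obtain g where g: "\<And>f. f \<in> ?Y \<union> {\<alpha>} \<Longrightarrow> le_on \<F> f g" by (auto simp: bounded_wrt_def)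
    obtain s where s: "infinite s" "infinite (- s)" "le_on \<F> g (enumerate s)"
      "\<exists>\<^sub>\<infinity>p. {p..p + \<alpha> p} \<subseteq> s" "\<exists>\<^sub>\<infinity>p. {p..p + \<alpha> p} \<inter> s = {}"
      using exists_block_set[OF sf nm] .
    have "le_on \<F> f' (enumerate s)" if "f' \<in> ?Y \<union> {\<alpha>}" for f'
      using \<F> g[OF that] s(3) by (rule le_on_trans)
    then have "?P f \<alpha> s" using s by auto
    then show ?thesis by blast
  qed simp
  ultimately have "\<exists>f. \<forall>\<alpha>. ?P f \<alpha> (f \<alpha>)"
    by (rule dependent_wf_choice)
  then show ?thesis using that by blast
qed

section \<open>Finite powers\<close>

text \<open>There are finitely many tuples \<open>q\<close> of subsets of \<open>{..<m}\<close>, all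
  of them points of the power, and the \<open>n\<close>-th value of \<phi> is constant near each.
  For \<open>N\<close> above all their thresholds, a tuple \<open>x\<close> omitting
  \<open>{m..<N}\<close> is close enough to its own trace below \<open>m\<close> to share its
  value.\<close>

lemma continuous_on_power_gap_bound:
  assumes I: "finite I" and X: "finite_sets \<subseteq> X"
    and \<phi>: "continuous_map (product_topology (\<lambda>_. subtopology power_nat X) I) baire_space \<phi>"
  obtains N V where "\<And>x. x \<in> Pi\<^sub>E I (\<lambda>_. X) \<Longrightarrow> \<forall>i\<in>I. x i \<inter> {m..<N} = {} \<Longrightarrow> \<phi> x n \<le> V"
proof -
  let ?T = "product_topology (\<lambda>_. subtopology power_nat X) I"
  let ?Q = "Pi\<^sub>E I (\<lambda>_. Pow {..<m})"
  have cont: "continuous_map ?T (discrete_topology UNIV) (\<lambda>x. \<phi> x n)"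
    using \<phi> by (simp add: baire_space_def continuous_map_componentwise_UNIV)
  have "\<exists>N. \<forall>x\<in>Pi\<^sub>E I (\<lambda>_. X). (\<forall>i\<in>I. x i \<inter> {..<N} = q i \<inter> {..<N}) \<longrightarrow> \<phi> x n = \<phi> q n"
    if q: "q \<in> ?Q" for q
  proof -
    have "q i \<in> X" if "i \<in> I" for i
    proof -
      have "finite (q i)" using PiE_mem[OF q that] finite_subset by auto
      then show ?thesis using X unfolding finite_sets_def by blast
    qed
    then have qX: "q \<in> Pi\<^sub>E I (\<lambda>_. X)" using q by (simp add: PiE_iff)
    let ?W = "{x \<in> topspace ?T. \<phi> x n \<in> {\<phi> q n}}"
    have "openin ?T ?W" using cont by (rule openin_continuous_map_preimage) simp
    moreover have "q \<in> ?W" using qX by simp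
    ultimately obtain N where N: "\<And>x. x \<in> Pi\<^sub>E I (\<lambda>_. X) \<Longrightarrow>
        \<forall>i\<in>I. x i \<inter> {..<N} = q i \<inter> {..<N} \<Longrightarrow> x \<in> ?W"
      using product_power_nat_nbhd[OF I] by blast
    then show ?thesis by blast
  qed
  then obtain M where M: "\<And>q x. q \<in> ?Q \<Longrightarrow> x \<in> Pi\<^sub>E I (\<lambda>_. X) \<Longrightarrow>
      \<forall>i\<in>I. x i \<inter> {..<M q} = q i \<inter> {..<M q} \<Longrightarrow> \<phi> x n = \<phi> q n"
    by metis
  have finQ: "finite ?Q" using I by (simp add: finite_PiE)
  show ?thesis
  proof (rule that)
    fix x assume x: "x \<in> Pi\<^sub>E I (\<lambda>_. X)" "\<forall>i\<in>I. x i \<inter> {m..<Max (M ` ?Q)} = {}"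
    let ?q = "\<lambda>i\<in>I. x i \<inter> {..<m}"
    have q: "?q \<in> ?Q" by auto
    have MM: "M ?q \<le> Max (M ` ?Q)" using finQ q by (intro Max_ge) auto
    have "\<forall>i\<in>I. x i \<inter> {..<M ?q} = ?q i \<inter> {..<M ?q}"
    proof
      fix i assume i: "i \<in> I"
      have "s < m" if "s \<in> x i" "s < M ?q" for s
      proof (rule ccontr)
        assume "\<not> s < m"
        then have "s \<in> x i \<inter> {m..<Max (M ` ?Q)}" using that MM by simp
        then show False using x(2) i by blast
      qed
      then show "x i \<inter> {..<M ?q} = ?q i \<inter> {..<M ?q}" using i by auto
    qed
    then have "\<phi> x n = \<phi> ?q n" by (rule M[OF q x(1)])
    also have "\<dots> \<le> Max ((\<lambda>q. \<phi> q n) ` ?Q)" using finQ q by (intro Max_ge) auto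
    finally show "\<phi> x n \<le> Max ((\<lambda>q. \<phi> q n) ` ?Q)" .
  qed
qed

text \<open>For each \<open>n\<close>, iterating the gap bound gives consecutive intervals, each
  long enough to bound the \<open>n\<close>-th value of \<phi> once all coordinates omit it.
  \<open>g n\<close> is the end of interval number \<open>card I * n\<close>, so
  \<open>common_gap\<close> finds an omitted one, and \<open>h n\<close> sums the bounds of all
  candidates.\<close>

lemma continuous_on_power_bound:
  assumes I: "finite I" and X: "finite_sets \<subseteq> X"
    and \<phi>: "continuous_map (product_topology (\<lambda>_. subtopology power_nat X) I) baire_space \<phi>"
  obtains g h where "\<And>x n. x \<in> Pi\<^sub>E I (\<lambda>_. X) \<Longrightarrow> \<forall>i\<in>I. infinite (x i) \<and> g n \<le> enumerate (x i) n \<Longrightarrow>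
    \<phi> x n \<le> h n"
proof -
  have "\<exists>N V. \<forall>x\<in>Pi\<^sub>E I (\<lambda>_. X). (\<forall>i\<in>I. x i \<inter> {m..<N} = {}) \<longrightarrow> \<phi> x n \<le> V" for m n
    by (rule continuous_on_power_gap_bound[OF assms, of m n]) blast
  then obtain N V where NV: "\<And>m n x. x \<in> Pi\<^sub>E I (\<lambda>_. X) \<Longrightarrow> \<forall>i\<in>I. x i \<inter> {m..<N m n} = {} \<Longrightarrow> \<phi> x n \<le> V m n"
    by metis
  \<comment> \<open>\<open>Suc y\<close> keeps the endpoints strictly increasing even where
    \<open>N y n\<close> is not above \<open>y\<close>.\<close>
  define m where "m = (\<lambda>n. rec_nat 0 (\<lambda>_ y. max (Suc y) (N y n)))"
  have m: "m n (Suc j) = max (Suc (m n j)) (N (m n j) n)" for n j by (simp add: m_def)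
  have mono_m: "strict_mono (m n)" for n by (simp add: strict_mono_Suc_iff m less_max_iff_disj)
  show ?thesis
  proof (rule that)
    fix x n
    assume x: "x \<in> Pi\<^sub>E I (\<lambda>_. X)"
      and large: "\<forall>i\<in>I. infinite (x i) \<and> m n (Suc (card I * n)) \<le> enumerate (x i) n"
    obtain j where j: "j \<le> card I * n" "\<forall>i\<in>I. x i \<inter> {m n j..<m n (Suc j)} = {}"
      using common_gap[OF mono_m I, of x n n] large by blast
    have "{m n j..<N (m n j) n} \<subseteq> {m n j..<m n (Suc j)}" by (auto simp: m)
    then have "\<phi> x n \<le> V (m n j) n" by (intro NV x) (use j(2) in blast)
    also have "\<dots> \<le> (\<Sum>j\<le>card I * n. V (m n j) n)" using j(1) by (intro member_le_sum) auto
    finally show "\<phi> x n \<le> (\<Sum>j\<le>card I * n. V (m n j) n)" .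
  qed
qed

text \<open>\<open>conc\<close> is a concentration property: \<open>X\<close> lies above
  \<open>g\<close> modulo \<F> outside a set \<open>Z\<close> so small that all its images are
  bounded. Arbitrary finite index sets let the induction delete any coordinate.\<close>

lemma B_property_powers:
  assumes \<F>: "nat_filter \<F>" and X: "finite_sets \<subseteq> X"
    and conc: "\<And>g. \<exists>Z. (\<forall>x\<in>X - Z. infinite x \<and> le_on \<F> g (enumerate x)) \<and>
      (\<forall>h. bounded_wrt (le_on \<F>) (h ` Z))"
    and I: "finite I"
  shows "B_property \<F> (product_topology (\<lambda>_. subtopology power_nat X) I)"
  using I
proof (induction I rule: finite_psubset_induct)
  case (psubset I)
  have sf: "semifilter \<F>" using \<F> by (simp add: nat_filter_def)
  let ?T = "\<lambda>I. product_topology (\<lambda>_. subtopology power_nat X) I"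
  show ?case
    unfolding B_property_def
  proof (intro allI impI)
    fix \<phi> assume \<phi>: "continuous_map (?T I) baire_space \<phi>"
    obtain g h where gh: "\<And>x n. x \<in> Pi\<^sub>E I (\<lambda>_. X) \<Longrightarrow>
        \<forall>i\<in>I. infinite (x i) \<and> g n \<le> enumerate (x i) n \<Longrightarrow> \<phi> x n \<le> h n"
      by (rule continuous_on_power_bound[OF psubset.hyps X \<phi>]) blast
    obtain Z where Z: "\<And>x. x \<in> X - Z \<Longrightarrow> infinite x \<and> le_on \<F> g (enumerate x)"
      "\<And>h :: nat set \<Rightarrow> nat \<Rightarrow> nat. bounded_wrt (le_on \<F>) (h ` Z)"
      using conc[of g] by blast
    have "\<exists>h. \<forall>x\<in>Pi\<^sub>E I (\<lambda>_. X). x i = y \<longrightarrow> le_on \<F> (\<phi> x) h" if i: "i \<in> I" for i y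
    proof (cases "y \<in> X")
      case False
      then show ?thesis using i by (auto simp: PiE_iff)
    next
      case True
      \<comment> \<open>\<open>?e\<close> parametrizes the slice with coordinate \<open>i\<close>
        equal to \<open>y\<close> by the power over \<open>I - {i}\<close>, where the induction
        hypothesis applies.\<close>
      let ?e = "\<lambda>x. x(i := y)"
      have "continuous_map (?T (I - {i})) (?T I) ?e"
        unfolding continuous_map_componentwise
      proof (intro conjI ballI)
        show "?e ` topspace (?T (I - {i})) \<subseteq> extensional I"
        proof (rule image_subsetI)
          fix x assume "x \<in> topspace (?T (I - {i}))"
          then have "x \<in> extensional (I - {i})" by (simp add: PiE_iff)
          then show "?e x \<in> extensional I"
            using i unfolding extensional_def mem_Collect_eq by (metis Diff_iff fun_upd_apply)
        qed
        fix j assume "j \<in> I"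
        then show "continuous_map (?T (I - {i})) (subtopology power_nat X) (\<lambda>x. ?e x j)"
          using True by (cases "j = i") (auto intro: continuous_map_product_projection)
      qed
      then have "continuous_map (?T (I - {i})) baire_space (\<phi> \<circ> ?e)"
        using \<phi> by (rule continuous_map_compose)
      moreover have "B_property \<F> (?T (I - {i}))" using i by (intro psubset.IH) auto
      ultimately obtain h where h: "\<And>x. x \<in> topspace (?T (I - {i})) \<Longrightarrow> le_on \<F> ((\<phi> \<circ> ?e) x) h"
        unfolding B_property_def bounded_wrt_def by blast
      have "le_on \<F> (\<phi> x) h" if x: "x \<in> Pi\<^sub>E I (\<lambda>_. X)" "x i = y" for x
      proof -
        have "restrict x (I - {i}) \<in> topspace (?T (I - {i}))" using x(1) by (auto simp: PiE_iff)
        moreover have "?e (restrict x (I - {i})) = x"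
          using x i by (auto simp: fun_eq_iff PiE_iff extensional_def)
        ultimately show ?thesis using h by fastforce
      qed
      then show ?thesis by blast
    qed
    then obtain H where H: "\<And>i x. i \<in> I \<Longrightarrow> x \<in> Pi\<^sub>E I (\<lambda>_. X) \<Longrightarrow> le_on \<F> (\<phi> x) (H i (x i))"
      by metis
    \<comment> \<open>The slice bounds \<open>H i y\<close> for \<open>y\<close> in \<open>Z\<close>
      form an image of \<open>Z\<close>, hence have a common bound.\<close>
    have "\<exists>K. \<forall>y\<in>Z. le_on \<F> (H i y) K" for i
      using Z(2)[of "H i"] by (auto simp: bounded_wrt_def)
    then obtain K where K: "\<And>i y. y \<in> Z \<Longrightarrow> le_on \<F> (H i y) (K i)" by metis
    let ?b = "\<lambda>n. h n + (\<Sum>i\<in>I. K i n)"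
    have "le_on \<F> (\<phi> x) ?b" if x: "x \<in> Pi\<^sub>E I (\<lambda>_. X)" for x
    proof (cases "\<exists>i\<in>I. x i \<in> Z")
      case True
      then obtain i where i: "i \<in> I" "x i \<in> Z" by blast
      have "le_on \<F> (\<phi> x) (K i)" using \<F> H[OF i(1) x] K[OF i(2)] by (rule le_on_trans)
      then show ?thesis
      proof (rule le_on_le[OF sf])
        show "K i n \<le> ?b n" for n
          using psubset.hyps i(1) member_le_sum[of i I "\<lambda>i. K i n"] by simp
      qed simp
    next
      case False
      then have x': "infinite (x i)" "le_on \<F> g (enumerate (x i))" if "i \<in> I" for i
        using Z(1)[of "x i"] PiE_mem[OF x that] that by auto
      have "{n. \<forall>i\<in>I. n \<in> {n. g n \<le> enumerate (x i) n}} \<in> \<F>"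
        using \<F> psubset.hyps by (rule nat_filter_INT) (use x'(2) in \<open>auto simp: le_on_def\<close>)
      moreover have "\<phi> x n \<le> ?b n" if "\<forall>i\<in>I. g n \<le> enumerate (x i) n" for n
      proof -
        have "\<phi> x n \<le> h n" by (rule gh[OF x]) (use that x'(1) in blast)
        then show ?thesis by simp
      qed
      then have "{n. \<forall>i\<in>I. n \<in> {n. g n \<le> enumerate (x i) n}} \<subseteq> {n. \<phi> x n \<le> ?b n}"
        by blast
      ultimately show ?thesis unfolding le_on_def by (rule semifilter_mono[OF sf])
    qed
    then show "bounded_wrt (le_on \<F>) (\<phi> ` topspace (?T I))"
      unfolding bounded_wrt_def by (intro exI[of _ ?b]) auto
  qed
qed

section \<open>The splitting and unbounded copy\<close>

text \<open>If \<open>{p..p + d p}\<close> lies in \<open>a\<close>, then at most \<open>p\<close>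
  elements of \<open>- a\<close> are below \<open>Suc (p + d p)\<close>, which pushes element number
  \<open>p\<close> of \<open>- a\<close> above \<open>d p\<close>.\<close>

lemma complement_of_blocks_not_le_star:
  assumes "infinite (- a)" and "\<exists>\<^sub>\<infinity>p. {p..p + d p} \<subseteq> a"
  shows "\<not> le_star (enumerate (- a)) d"
proof
  assume "le_star (enumerate (- a)) d"
  then have "\<forall>\<^sub>\<infinity>p. \<not> {p..p + d p} \<subseteq> a"
    unfolding le_star_def
  proof (rule MOST_mono)
    fix p assume le: "enumerate (- a) p \<le> d p"
    show "\<not> {p..p + d p} \<subseteq> a"
    proof
      assume sub: "{p..p + d p} \<subseteq> a"
      have "- a \<inter> {..<Suc (p + d p)} \<subseteq> {..<p}"
      proof
        fix s assume s: "s \<in> - a \<inter> {..<Suc (p + d p)}"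
        show "s \<in> {..<p}"
        proof (rule ccontr)
          assume "s \<notin> {..<p}"
          then have "s \<in> {p..p + d p}" using s by simp
          then show False using sub s by blast
        qed
      qed
      then have "card (- a \<inter> {..<Suc (p + d p)}) \<le> card {..<p}" by (intro card_mono) auto
      then have "Suc (p + d p) \<le> enumerate (- a) p"
        using assms(1) by (intro enumerate_ge) simp_all
      then show False using le by simp
    qed
  qed
  then show False using assms(2) unfolding frequently_def by blast
qed

lemma le_star_trans: "le_star f g \<Longrightarrow> le_star g h \<Longrightarrow> le_star f h"
  unfolding le_star_def by (erule (1) MOST_rev_mp[OF _ MOST_rev_mp]) (auto intro: order_trans)

text \<open>\<open>h p\<close> is the distance from \<open>p\<close> to the next element of
  \<open>A\<close>. Once \<open>d\<close> is above it, every interval \<open>{p..p + d p}\<close>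
  meets \<open>A\<close>.\<close>

lemma splitting_blocks:
  assumes A: "infinite A"
  obtains h :: "nat \<Rightarrow> nat" where "\<And>d a. le_star h d \<Longrightarrow> \<exists>\<^sub>\<infinity>p. {p..p + d p} \<subseteq> a \<Longrightarrow> infinite (A \<inter> a)"
proof -
  let ?h = "\<lambda>p. LEAST x. p + x \<in> A"
  have h: "p + ?h p \<in> A" for p
  proof -
    obtain x where "p \<le> x" "x \<in> A" using A by (auto simp: infinite_nat_iff_unbounded_le)
    then have "p + (x - p) \<in> A" by simp
    then show ?thesis by (rule LeastI)
  qed
  have "infinite (A \<inter> a)" if d: "le_star ?h d" and a: "\<exists>\<^sub>\<infinity>p. {p..p + d p} \<subseteq> a" for d a
    unfolding infinite_nat_iff_unbounded_le
  proof
    fix N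
    obtain K where K: "\<And>p. p \<ge> K \<Longrightarrow> ?h p \<le> d p"
      using d unfolding le_star_def MOST_nat_le by blast
    obtain p where p: "p \<ge> max N K" "{p..p + d p} \<subseteq> a" using a unfolding INFM_nat_le by blast
    have "p + ?h p \<in> {p..p + d p}" using K[of p] p(1) by simp
    then have "p + ?h p \<in> A \<inter> a" using p(2) h[of p] by blast
    moreover have "N \<le> p + ?h p" using p(1) by simp
    ultimately show "\<exists>n\<ge>N. n \<in> A \<inter> a" by blast
  qed
  then show ?thesis using that by blast
qed

theorem theorem8p6:
  fixes \<F> :: "nat set set"
  assumes "regularCard \<dd>"
    and "nat_filter \<F>"
    and "\<not> meager_in power_nat \<F>"
    and "\<bb> \<F> =o \<dd>"
  shows "\<exists>(a :: (nat \<Rightarrow> nat) \<Rightarrow> nat set) S X X'.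
    S = a ` Field \<dd> \<and> S \<subseteq> infinite_coinfinite_sets \<and>
    cofinal_b_scale \<F> \<dd> (\<lambda>\<alpha>. enumerate (a \<alpha>)) \<and>
    X = S \<union> finite_sets \<and>
    (\<forall>k. B_property \<F> (finite_power (subtopology power_nat X) k)) \<and>
    X' = (\<lambda>x. - x) ` X \<and>
    homeomorphic_map (subtopology power_nat X) (subtopology power_nat X') (\<lambda>x. - x) \<and>
    X' \<subseteq> infinite_sets \<and> splitting X' \<and>
    \<not> bounded_wrt le_star (enumerate ` X')"
proof -
  note \<F> = assms(2)
  have sf: "semifilter \<F>" using \<F> by (simp add: nat_filter_def)
  have card: "Card_order \<dd>" unfolding \<dd>_def by (rule Card_order_min_card)
  have iso: "\<dd> =o \<bb> \<F>" using assms(4) by (rule ordIso_symmetric)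
  obtain D where D: "dominating D" "\<dd> = |D|"
    using min_card_witness[of dominating, OF dominating_UNIV] unfolding \<dd>_def by blast
  have dom: "\<exists>\<alpha>\<in>Field \<dd>. le_star g \<alpha>" for g
    using D(1) unfolding D(2) Field_card_of dominating_def by blast
  obtain a where a: "\<And>\<alpha>. \<alpha> \<in> Field \<dd> \<Longrightarrow> infinite (a \<alpha>) \<and> infinite (- a \<alpha>) \<and>
      le_on \<F> \<alpha> (enumerate (a \<alpha>)) \<and>
      (\<exists>\<^sub>\<infinity>p. {p..p + \<alpha> p} \<subseteq> a \<alpha>) \<and> (\<exists>\<^sub>\<infinity>p. {p..p + \<alpha> p} \<inter> a \<alpha> = {}) \<and>
      (\<forall>\<beta>\<in>underS \<dd> \<alpha>. le_on \<F> (enumerate (a \<beta>)) (enumerate (a \<alpha>)))"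
    by (rule exists_scale[OF \<F> assms(3) card iso]) blast
  have mono: "le_on \<F> (enumerate (a \<alpha>)) (enumerate (a \<beta>))" if "(\<alpha>, \<beta>) \<in> \<dd>" "\<alpha> \<noteq> \<beta>" for \<alpha> \<beta>
  proof -
    have "\<beta> \<in> Field \<dd>" using that(1) by (rule FieldI2)
    moreover have "\<alpha> \<in> underS \<dd> \<beta>" using that by (simp add: underS_def)
    ultimately show ?thesis using a by blast
  qed
  \<comment> \<open>For \<alpha> above \<open>g\<close>, the chain from \<open>g\<close> to
    \<alpha>, to its scale member and to every later member is increasing modulo \<F>.\<close>
  have cof: "\<exists>\<alpha>\<in>Field \<dd>. \<forall>\<beta>. (\<alpha>, \<beta>) \<in> \<dd> \<longrightarrow> le_on \<F> g (enumerate (a \<beta>))" for g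
  proof -
    obtain \<alpha> where \<alpha>: "\<alpha> \<in> Field \<dd>" "le_star g \<alpha>" using dom by blast
    have g: "le_on \<F> g (enumerate (a \<alpha>))"
      using \<F> le_star_imp_le_on[OF sf \<alpha>(2)] by (rule le_on_trans) (use a \<alpha>(1) in blast)
    have "le_on \<F> g (enumerate (a \<beta>))" if "(\<alpha>, \<beta>) \<in> \<dd>" for \<beta>
      using g mono[OF that] le_on_trans[OF \<F> g] by (cases "\<alpha> = \<beta>") auto
    then show ?thesis using \<alpha>(1) by blast
  qed
  define S where "S = a ` Field \<dd>"
  define X where "X = S \<union> finite_sets"
  define X' where "X' = (\<lambda>x. - x) ` X"
  have S: "S \<subseteq> infinite_coinfinite_sets"
    using a by (auto simp: S_def infinite_coinfinite_sets_def)
  have scale: "cofinal_b_scale \<F> \<dd> (\<lambda>\<alpha>. enumerate (a \<alpha>))"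
    unfolding cofinal_b_scale_def
    using card iso a mono cof by (auto intro!: strict_monoI enumerate_mono)
  have conc: "\<exists>Z. (\<forall>x\<in>X - Z. infinite x \<and> le_on \<F> g (enumerate x)) \<and>
      (\<forall>h. bounded_wrt (le_on \<F>) (h ` Z))" for g
  proof -
    obtain \<alpha> where \<alpha>: "\<alpha> \<in> Field \<dd>"
      "\<And>\<beta>. (\<alpha>, \<beta>) \<in> \<dd> \<Longrightarrow> le_on \<F> g (enumerate (a \<beta>))"
      using cof by blast
    \<comment> \<open>The exceptional set is \<open>?U\<close> with the finite sets: minimality of
      \<open>\<bb> \<F>\<close> bounds images of the former, the diagonal bound those of the
      latter.\<close>
    let ?U = "a ` underS \<dd> \<alpha>"
    have "infinite x \<and> le_on \<F> g (enumerate x)" if x: "x \<in> X - (?U \<union> finite_sets)" for x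
    proof -
      obtain \<beta> where \<beta>: "\<beta> \<in> Field \<dd>" "x = a \<beta>" using x by (auto simp: X_def S_def)
      have "\<beta> \<notin> underS \<dd> \<alpha>" using x \<beta>(2) by blast
      moreover have "wo_rel \<dd>" using card by (rule Card_order_wo_rel)
      then have "(\<alpha>, \<beta>) \<in> \<dd> \<or> (\<beta>, \<alpha>) \<in> \<dd>" "(\<alpha>, \<alpha>) \<in> \<dd>"
        using wo_rel.TOTALS[of \<dd>] \<alpha>(1) \<beta>(1) by blast+
      ultimately have "(\<alpha>, \<beta>) \<in> \<dd>" unfolding underS_def by blast
      then show ?thesis using \<alpha>(2) \<beta> a by blast
    qed
    moreover have "bounded_wrt (le_on \<F>) (h ` (?U \<union> finite_sets))" for h
    proof -
      have "|h ` ?U| \<le>o |?U|" by (rule card_of_image)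
      also have "|?U| \<le>o |underS \<dd> \<alpha>|" by (rule card_of_image)
      also have "|underS \<dd> \<alpha>| <o \<dd>" using card \<alpha>(1) by (rule card_of_underS)
      also have "\<dd> =o \<bb> \<F>" by (rule iso)
      finally have "bounded_wrt (le_on \<F>) (h ` ?U)" by (rule bounded_wrt_small[OF sf])
      moreover have "countable finite_sets"
        unfolding finite_sets_def by (rule countable_Collect_finite)
      then have "bounded_wrt (le_on \<F>) (h ` finite_sets)"
        by (intro bounded_wrt_countable[OF sf] countable_image)
      ultimately show ?thesis unfolding image_Un by (rule bounded_wrt_Un[OF sf])
    qed
    ultimately show ?thesis by blast
  qed
  have powers: "B_property \<F> (finite_power (subtopology power_nat X) k)" for k
    unfolding finite_power_def by (rule B_property_powers[OF \<F> _ conc]) (auto simp: X_def)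
  have homeo: "homeomorphic_map (subtopology power_nat X) (subtopology power_nat X') (\<lambda>x. - x)"
    using homeomorphic_map_uminus_power_nat
    by (rule homeomorphic_map_subtopologies) (simp add: X'_def)
  have inf: "X' \<subseteq> infinite_sets"
    using S by (auto simp: X'_def X_def infinite_sets_def infinite_coinfinite_sets_def
        finite_sets_def Compl_eq_Diff_UNIV)
  have split: "splitting X'"
    unfolding splitting_def
  proof
    fix A assume "A \<in> infinite_sets"
    then have "infinite A" by (simp add: infinite_sets_def)
    then obtain h where h: "\<And>d a. le_star h d \<Longrightarrow> \<exists>\<^sub>\<infinity>p. {p..p + d p} \<subseteq> a \<Longrightarrow> infinite (A \<inter> a)"
      by (rule splitting_blocks) blast
    obtain \<alpha> where \<alpha>: "\<alpha> \<in> Field \<dd>" "le_star h \<alpha>" using dom by blast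
    \<comment> \<open>The same \<open>h\<close> is applied to \<open>a \<alpha>\<close> and to its
      complement, as both contain infinitely many of the intervals given by \<alpha>.\<close>
    have "\<exists>\<^sub>\<infinity>p. {p..p + \<alpha> p} \<subseteq> - a \<alpha>" using a[OF \<alpha>(1)] by (simp add: disjoint_eq_subset_Compl)
    then have "infinite (A \<inter> - a \<alpha>)" by (rule h[OF \<alpha>(2)])
    moreover have "infinite (A - - a \<alpha>)" using h[OF \<alpha>(2)] a[OF \<alpha>(1)] by (simp add: Diff_eq)
    moreover have "- a \<alpha> \<in> X'" using \<alpha>(1) by (auto simp: X'_def X_def S_def)
    ultimately show "\<exists>B\<in>X'. infinite (A \<inter> B) \<and> infinite (A - B)" by blast
  qed
  have unb: "\<not> bounded_wrt le_star (enumerate ` X')"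
  proof
    assume "bounded_wrt le_star (enumerate ` X')"
    then obtain h where h: "\<And>x. x \<in> X' \<Longrightarrow> le_star (enumerate x) h" by (auto simp: bounded_wrt_def)
    obtain \<alpha> where \<alpha>: "\<alpha> \<in> Field \<dd>" "le_star h \<alpha>" using dom by blast
    have "- a \<alpha> \<in> X'" using \<alpha>(1) by (auto simp: X'_def X_def S_def)
    then have "le_star (enumerate (- a \<alpha>)) \<alpha>" using h \<alpha>(2) le_star_trans by blast
    moreover have "\<not> le_star (enumerate (- a \<alpha>)) \<alpha>"
      using a[OF \<alpha>(1)] by (intro complement_of_blocks_not_le_star) auto
    ultimately show False by blast
  qed
  show ?thesis
    by (rule exI[of _ a], rule exI[of _ S], rule exI[of _ X], rule exI[of _ X'], intro conjI allI)
      (rule S_def S scale X_def powers X'_def homeo inf split unb)+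
qed

end
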